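(* $$\int_0^1\frac{\mathbf K\big(2\sqrt{x(1-x)}\big)\,\big(4x+3\sqrt{2}-2\big)}{\big(4\sqrt{2}+9-8\sqrt{2}\,x\big)^{3/2}}\,dx=\frac{\pi}{4\sqrt{2}}.$$
   Context: $\mathbf K(k)=\int_0^{\pi/2}\frac{d\theta}{\sqrt{1-k^2\sin^2\theta}}$ denotes the complete elliptic integral of the first kind with modulus $k$. *)

theory Defs
  imports "HOL-Analysis.Analysis"
begin

text \<open>
  The argument is the modulus \<open>k\<close>, not the parameter \<open>m = k\<^sup>2\<close>. The integrand is integrable for
  \<open>\<bar>k\<bar> < 1\<close>; at \<open>\<bar>k\<bar> = 1\<close> the integral diverges and the value is the default \<open>0\<close> of \<^const>\<open>integral\<close>.
\<close>

definition ellipticK :: "real \<Rightarrow> real" where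
  "ellipticK k = integral {0..pi/2} (\<lambda>\<theta>. 1 / sqrt (1 - k\<^sup>2 * (sin \<theta>)\<^sup>2))"

end

theory Submission
  imports Defs "HOL-Real_Asymp.Real_Asymp"
begin

text \<open>
  With \<open>t = 1 - 2 x\<close> the squared modulus becomes \<open>1 - t\<^sup>2\<close>, so the elliptic integral is \<open>K'(\<bar>t\<bar>)\<close>, the
  complementary one, and the claim reads
  \<open>1/2 * \<integral> K'(\<bar>t\<bar>) w(t) dt = pi / (4 sqrt 2)\<close> over \<open>[-1, 1]\<close>, where
  \<open>w(t) = (3 sqrt 2 - 2 t) / (9 + 4 sqrt 2 t) powr (3/2)\<close>. Only the even part of \<open>w\<close> matters. Its
  Taylor series converges on \<open>[-1, 1]\<close> and has positive coefficients (\<open>weight_even_part_sums\<close>), so it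
  can be integrated term by term. In the comments, \<open>a\<^sub>k = (1/2)\<^sub>k / k!\<close> is the Wallis coefficient
  \<open>wallis_coeff k\<close>.

  Substituting \<open>v\<^sup>2 = 1 - (1 - t\<^sup>2) sin\<^sup>2 \<theta>\<close> writes \<open>K'(t)\<close> as the integral of
  \<open>1 / (sqrt (1 - v\<^sup>2) sqrt (v\<^sup>2 - t\<^sup>2))\<close> over \<open>(t, 1)\<close>. This is a multiplicative convolution: up to
  normalisation \<open>K'\<close> is the density of a product of two independent arcsine variables. Hence its
  \<open>2k\<close>-th moment is the square of a Wallis integral, \<open>(pi/2 * a\<^sub>k)\<^sup>2\<close> (\<open>complementary_K_moment\<close>), and the
  whole integral reduces to Ramanujan's series
  \<open>\<Sum>k. (7 k + 1) a\<^sub>2\<^sub>k a\<^sub>k\<^sup>2 (32/81)\<^sup>k = 9 / (2 pi)\<close> (\<open>ramanujan_series_32_81\<close>).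

  That series is obtained from another one of Ramanujan's,
  \<open>\<Sum>n. (6 n + 1) (-1/8)\<^sup>n a\<^sub>n\<^sup>3 = 2 sqrt 2 / pi\<close> (\<open>ramanujan_series_8\<close>), which has a
  Wilf--Zeilberger proof. The bridge comes from the generating function of the Legendre polynomials:
  \<open>9 + 4 sqrt 2 t = 8 (1 + 2 r t + r\<^sup>2)\<close> for \<open>r = 1 / sqrt 8\<close>. Expanding powers of
  \<open>1 + 2 r t + r\<^sup>2\<close> in powers of \<open>r\<close>, or in powers of \<open>t\<close>, and replacing \<open>t\<^sup>2\<^sup>k\<close> by
  \<open>a\<^sub>k\<^sup>2\<close> sums one absolutely convergent double series along its diagonals or along its rows. The
  diagonals give multiples of \<open>a\<^sub>n\<^sup>3\<close> by a case of the Pfaff--Saalschuetz theorem (\<open>sum_legendre_mean_term\<close>), the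
  rows by the binomial series.
\<close>

section \<open>Wallis coefficients\<close>

definition wallis_coeff :: "nat \<Rightarrow> real" where
  "wallis_coeff n = pochhammer (1/2) n / fact n"

lemma wallis_coeff_0 [simp]: "wallis_coeff 0 = 1"
  by (simp add: wallis_coeff_def)

lemma wallis_coeff_Suc:
  "wallis_coeff (Suc n) = (real n + 1/2) / (real n + 1) * wallis_coeff n"
  by (simp add: wallis_coeff_def pochhammer_Suc field_simps)

lemma wallis_coeff_pos: "wallis_coeff n > 0"
  by (simp add: wallis_coeff_def pochhammer_pos)

lemma wallis_coeff_le_1: "wallis_coeff n \<le> 1"
proof (induction n)
  case (Suc n)
  have "(real n + 1/2) / (real n + 1) * wallis_coeff n \<le> 1 * 1"
    using Suc wallis_coeff_pos[of n] by (intro mult_mono) (auto simp: field_simps)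
  then show ?case by (simp add: wallis_coeff_Suc)
qed simp

lemma pochhammer_half_double:
  "pochhammer (1/2 :: real) n = fact (2 * n) / (4 ^ n * fact n)"
  by (simp add: fact_double power_mult)

text \<open>
  The Wallis product for \<open>pi / 2\<close> has exactly the reciprocals of these numbers as partial products.
  It is the only source of \<open>pi\<close> in the two series below.
\<close>
lemma wallis_coeff_sq_tendsto: "(\<lambda>n. (2 * real n + 1) * wallis_coeff n ^ 2) \<longlonglongrightarrow> 2 / pi"
proof -
  have eq: "(\<Prod>k=1..n. (4*real k^2) / (4*real k^2 - 1)) = inverse ((2 * real n + 1) * wallis_coeff n ^ 2)" for n
  proof (induction n)
    case (Suc n)
    have pos: "4 * (real n + 1)^2 - 1 = (2 * real n + 1) * (2 * real n + 3)"
      by (simp add: power2_eq_square algebra_simps)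
    have "(\<Prod>k=1..Suc n. (4*real k^2) / (4*real k^2 - 1))
        = inverse ((2 * real n + 1) * wallis_coeff n ^ 2) * ((4 * (real n + 1)^2) / ((2 * real n + 1) * (2 * real n + 3)))"
      using Suc pos by (simp add: add.commute)
    also have "\<dots> = inverse ((2 * real (Suc n) + 1) * wallis_coeff (Suc n) ^ 2)"
    proof -
      define m :: real where "m = real n"
      define w where "w = wallis_coeff n"
      have "m \<ge> 0" "w > 0" by (auto simp: m_def w_def wallis_coeff_pos)
      then show ?thesis
        unfolding wallis_coeff_Suc of_nat_Suc m_def[symmetric] w_def[symmetric]
        by (simp add: divide_simps add_nonneg_eq_0_iff power2_eq_square) algebra
    qed
    finally show ?case .
  qed simp
  have "(\<lambda>n. inverse ((2 * real n + 1) * wallis_coeff n ^ 2)) \<longlonglongrightarrow> pi / 2"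
    using wallis by (simp only: eq)
  from tendsto_inverse[OF this] show ?thesis by simp
qed

lemma wallis_coeff_mult_tendsto:
  "(\<lambda>k. (4 * real k + 1) * (wallis_coeff (2 * k) * wallis_coeff k)) \<longlonglongrightarrow> 2 * sqrt 2 / pi"
proof -
  have 1: "(\<lambda>k. (2 * real (2 * k) + 1) * wallis_coeff (2 * k) ^ 2) \<longlonglongrightarrow> 2 / pi"
    using LIMSEQ_subseq_LIMSEQ[OF wallis_coeff_sq_tendsto, of "\<lambda>k. 2 * k"]
    by (simp add: strict_mono_def o_def)
  have 2: "(\<lambda>k::nat. (4 * real k + 1) / (2 * real k + 1)) \<longlonglongrightarrow> 2"
    by real_asymp
  have "(\<lambda>k. sqrt (((2 * real (2 * k) + 1) * wallis_coeff (2 * k) ^ 2)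
           * ((2 * real k + 1) * wallis_coeff k ^ 2) * ((4 * real k + 1) / (2 * real k + 1))))
        \<longlonglongrightarrow> sqrt (2 / pi * (2 / pi) * 2)"
    by (intro tendsto_intros 1 2 wallis_coeff_sq_tendsto)
  also have "sqrt (2 / pi * (2 / pi) * 2) = 2 * sqrt 2 / pi"
    by (simp only: real_sqrt_mult) simp
  also have "(\<lambda>k. sqrt (((2 * real (2 * k) + 1) * wallis_coeff (2 * k) ^ 2)
           * ((2 * real k + 1) * wallis_coeff k ^ 2) * ((4 * real k + 1) / (2 * real k + 1))))
      = (\<lambda>k. (4 * real k + 1) * (wallis_coeff (2 * k) * wallis_coeff k))"
  proof
    fix k :: nat
    have "((2 * real (2 * k) + 1) * wallis_coeff (2 * k) ^ 2)
           * ((2 * real k + 1) * wallis_coeff k ^ 2) * ((4 * real k + 1) / (2 * real k + 1))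
        = ((4 * real k + 1) * (wallis_coeff (2 * k) * wallis_coeff k)) ^ 2"
      by (simp add: divide_simps power2_eq_square add_nonneg_eq_0_iff)
    then show "sqrt (((2 * real (2 * k) + 1) * wallis_coeff (2 * k) ^ 2)
           * ((2 * real k + 1) * wallis_coeff k ^ 2) * ((4 * real k + 1) / (2 * real k + 1)))
       = (4 * real k + 1) * (wallis_coeff (2 * k) * wallis_coeff k)"
      using wallis_coeff_pos[of k] wallis_coeff_pos[of "2*k"] by simp
  qed
  finally show ?thesis .
qed

section \<open>A Wilf--Zeilberger proof of Ramanujan's series with ratio \<open>-1/8\<close>\<close>

text \<open>
  The series of interest is the case \<open>k = 0\<close> of \<open>\<Sum>n. (6 n + 4 k + 1) * wz_term n k\<close>. The new parameter
  \<open>k\<close> is chosen such that this sum does not depend on it, while for \<open>k \<rightarrow> \<infinity>\<close> all terms but the one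
  with \<open>n = 0\<close> die out.
\<close>
definition wz_term :: "nat \<Rightarrow> nat \<Rightarrow> real" where
  "wz_term n k = (-1) ^ n * pochhammer (1/2) n ^ 2 * pochhammer (1/2) (n + 2 * k)
     / (8 ^ n * 4 ^ k * fact n * fact (n + k) ^ 2)"

lemma wz_term_Suc_left:
  "wz_term (Suc n) k = - ((real n + 1/2)^2 * (real n + 2 * real k + 1/2))
     / (8 * (real n + 1) * (real n + real k + 1)^2) * wz_term n k"
  unfolding wz_term_def by (simp add: pochhammer_Suc divide_simps power2_eq_square) (simp add: algebra_simps)

lemma wz_term_Suc_right:
  "wz_term n (Suc k) = (real n + 2 * real k + 1/2) * (real n + 2 * real k + 3/2)
     / (4 * (real n + real k + 1)^2) * wz_term n k"
  unfolding wz_term_def by (simp add: pochhammer_Suc divide_simps power2_eq_square) (simp add: algebra_simps)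

text \<open>
  With \<open>F n k = (6 n + 4 k + 1) * wz_term n k\<close> and \<open>G n k = 4 n * wz_term n k\<close> this is the
  Wilf--Zeilberger equation \<open>F n (k + 1) - F n k = G (n + 1) k - G n k\<close>. Dividing by \<open>wz_term n k\<close> turns
  it into an identity of rational functions.
\<close>
lemma wz_pair:
  "(6 * real n + 4 * real (Suc k) + 1) * wz_term n (Suc k) - (6 * real n + 4 * real k + 1) * wz_term n k
     = 4 * real (Suc n) * wz_term (Suc n) k - 4 * real n * wz_term n k"
proof -
  define x y h where "x = real n" and "y = real k" and "h = wz_term n k"
  have "x \<ge> 0" "y \<ge> 0" by (auto simp: x_def y_def)
  then have "x + 1 \<noteq> 0" "x + y + 1 \<noteq> 0" by auto
  then show ?thesis
    unfolding wz_term_Suc_left wz_term_Suc_right of_nat_Suc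
      x_def[symmetric] y_def[symmetric] h_def[symmetric]
    by (simp add: divide_simps add.commute) algebra
qed

lemma wz_term_0_left: "wz_term 0 k = wallis_coeff (2 * k) * wallis_coeff k"
  by (simp add: wz_term_def wallis_coeff_def pochhammer_half_double[of k] power2_eq_square)

lemma wz_term_0_right: "wz_term n 0 = (-1) ^ n * wallis_coeff n ^ 3 / 8 ^ n"
  by (simp add: wz_term_def wallis_coeff_def power2_eq_square power3_eq_cube field_simps)

text \<open>
  The one estimate behind both the domination in \<open>n\<close> (the factor is at most \<open>1/4\<close>) and the decay in \<open>k\<close>
  (the factor is \<open>O(1/k)\<close>).
\<close>
lemma abs_wz_term_Suc:
  "\<bar>wz_term (Suc n) k\<bar> \<le> (real n + 1) / (4 * (real n + real k + 1)) * \<bar>wz_term n k\<bar>"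
proof -
  define x y where "x = real n" and "y = real k"
  have xy: "x \<ge> 0" "y \<ge> 0" by (auto simp: x_def y_def)
  have "\<bar>- ((x + 1/2)^2 * (x + 2 * y + 1/2)) / (8 * (x + 1) * (x + y + 1)^2)\<bar>
      = ((x + 1/2)^2 * (x + 2 * y + 1/2)) / (8 * (x + 1) * (x + y + 1)^2)"
    using xy by (simp add: abs_mult abs_divide)
  also have "\<dots> \<le> ((x + 1)^2 * (2 * (x + y + 1))) / (8 * (x + 1) * (x + y + 1)^2)"
    using xy by (intro divide_right_mono mult_mono power_mono) auto
  also have "\<dots> = (x + 1) / (4 * (x + y + 1))"
    using xy by (simp add: divide_simps power2_eq_square add_nonneg_eq_0_iff) algebra
  finally show ?thesis
    unfolding wz_term_Suc_left abs_mult x_def y_def by (intro mult_right_mono) auto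
qed

lemma abs_wz_term_le: "\<bar>wz_term n k\<bar> \<le> wz_term 0 k / 4 ^ n"
proof (induction n)
  case 0
  then show ?case using wallis_coeff_pos[of k] wallis_coeff_pos[of "2*k"] by (simp add: wz_term_0_left)
next
  case (Suc n)
  have "\<bar>wz_term (Suc n) k\<bar> \<le> (real n + 1) / (4 * (real n + real k + 1)) * \<bar>wz_term n k\<bar>"
    by (rule abs_wz_term_Suc)
  also have "\<dots> \<le> 1 / 4 * (wz_term 0 k / 4 ^ n)"
    using Suc by (intro mult_mono) (auto simp: divide_simps)
  finally show ?case by simp
qed

lemma summable_linear_geometric:
  fixes a b q :: real
  assumes "0 \<le> q" "q < 1"
  shows "summable (\<lambda>n. (a * real n + b) * q ^ n)"
proof -
  have "summable (\<lambda>n. real (Suc n) * q ^ n)"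
    using geometric_deriv_sums[of q] assms by (auto simp: sums_iff)
  then have "summable (\<lambda>n. a * (real (Suc n) * q ^ n) + (b - a) * q ^ n)"
    using assms by (intro summable_add summable_mult summable_geometric) auto
  then show ?thesis by (simp add: algebra_simps)
qed

lemma wz_sum_summable: "summable (\<lambda>n. (6 * real n + 4 * real k + 1) * wz_term n k)"
proof (rule summable_comparison_test')
  show "summable (\<lambda>n. wz_term 0 k * ((6 * real n + (4 * real k + 1)) * (1/4) ^ n))"
    by (intro summable_mult summable_linear_geometric) auto
  fix n :: nat
  have "norm ((6 * real n + 4 * real k + 1) * wz_term n k) = (6 * real n + 4 * real k + 1) * \<bar>wz_term n k\<bar>"
    by (simp add: abs_mult)
  also have "\<dots> \<le> (6 * real n + 4 * real k + 1) * (wz_term 0 k / 4 ^ n)"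
    by (intro mult_left_mono abs_wz_term_le) auto
  finally show "norm ((6 * real n + 4 * real k + 1) * wz_term n k)
      \<le> wz_term 0 k * ((6 * real n + (4 * real k + 1)) * (1/4) ^ n)"
    by (simp add: field_simps power_divide)
qed

text \<open>
  Summing the Wilf--Zeilberger equation over \<open>n\<close> telescopes on the right-hand side: \<open>G\<close> vanishes at
  \<open>n = 0\<close> and tends to zero as \<open>n \<rightarrow> \<infinity>\<close>.
\<close>
lemma wz_sum_const:
  "(\<Sum>n. (6 * real n + 4 * real k + 1) * wz_term n k) = (\<Sum>n. (6 * real n + 1) * wz_term n 0)"
proof (induction k)
  case (Suc k)
  have "(\<lambda>n. 4 * real n * wz_term n k) \<longlonglongrightarrow> 0"
  proof (rule Lim_null_comparison)
    show "\<forall>\<^sub>F n in sequentially. norm (4 * real n * wz_term n k) \<le> 4 * real n * (wz_term 0 k / 4 ^ n)"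
      using abs_wz_term_le[of _ k]
      by (intro always_eventually allI) (auto simp: abs_mult simp del: times_divide_eq_right intro!: mult_left_mono)
    show "(\<lambda>n. 4 * real n * (wz_term 0 k / 4 ^ n)) \<longlonglongrightarrow> 0" by real_asymp
  qed
  from telescope_sums[OF this]
  have "(\<lambda>n. (6 * real n + 4 * real (Suc k) + 1) * wz_term n (Suc k)
            - (6 * real n + 4 * real k + 1) * wz_term n k) sums 0"
    unfolding wz_pair by simp
  then have "(\<Sum>n. (6 * real n + 4 * real (Suc k) + 1) * wz_term n (Suc k))
      - (\<Sum>n. (6 * real n + 4 * real k + 1) * wz_term n k) = 0"
    using suminf_diff[OF wz_sum_summable[of "Suc k"] wz_sum_summable[of k]] by (simp add: sums_iff)
  then show ?case using Suc by simp
qed simp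

text \<open>
  The sum is independent of \<open>k\<close>, so it equals its limit for \<open>k \<rightarrow> \<infinity>\<close>. By dominated convergence this is
  the limit of the term with \<open>n = 0\<close>, namely of \<open>(4 k + 1) a\<^sub>2\<^sub>k a\<^sub>k\<close>, which the Wallis product provides.
\<close>
lemma ramanujan_series_8:
  "(\<lambda>n. (6 * real n + 1) * ((-1) ^ n * wallis_coeff n ^ 3 / 8 ^ n)) sums (2 * sqrt 2 / pi)"
proof -
  let ?F = "\<lambda>n k. (6 * real n + 4 * real k + 1) * wz_term n k"
  have lim0: "(\<lambda>k. (4 * real k + 1) * wz_term 0 k) \<longlonglongrightarrow> 2 * sqrt 2 / pi"
    unfolding wz_term_0_left by (rule wallis_coeff_mult_tendsto)
  have wz0: "wz_term 0 k \<ge> 0" for k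
    using wallis_coeff_pos[of k] wallis_coeff_pos[of "2*k"] by (simp add: wz_term_0_left)
  obtain B where B: "\<And>k. \<bar>(4 * real k + 1) * wz_term 0 k\<bar> \<le> B"
    using convergent_imp_Bseq[OF convergentI[OF lim0]] by (auto simp: Bseq_def)
  have bound: "\<bar>?F n k\<bar> \<le> (6 * real n + 1) * (B * (1/4) ^ n)" for n k
  proof -
    have "\<bar>?F n k\<bar> \<le> ((6 * real n + 1) * (4 * real k + 1)) * (wz_term 0 k / 4 ^ n)"
      unfolding abs_mult using wz0[of k]
      by (intro mult_mono abs_wz_term_le) (auto simp: algebra_simps)
    also have "\<dots> = (6 * real n + 1) * (((4 * real k + 1) * wz_term 0 k) * (1/4) ^ n)"
      by (simp add: power_divide)
    also have "\<dots> \<le> (6 * real n + 1) * (B * (1/4) ^ n)"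
      using B[of k] by (intro mult_left_mono mult_right_mono) auto
    finally show ?thesis .
  qed
  have vanish: "(\<lambda>k. ?F (Suc n) k) \<longlonglongrightarrow> 0" for n
  proof (rule Lim_null_comparison)
    show "\<forall>\<^sub>F k in sequentially. norm (?F (Suc n) k) \<le> (6 * real n + 7) * B * ((real n + 1) / (real k + 1))"
    proof (intro always_eventually allI)
      fix k
      have "\<bar>wz_term (Suc n) k\<bar> \<le> (real n + 1) / (4 * (real n + real k + 1)) * \<bar>wz_term n k\<bar>"
        by (rule abs_wz_term_Suc)
      also have "\<dots> \<le> (real n + 1) / (real k + 1) * (wz_term 0 k / 4 ^ n)"
        by (intro mult_mono abs_wz_term_le divide_left_mono) auto
      also have "\<dots> \<le> (real n + 1) / (real k + 1) * (wz_term 0 k / 1)"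
        using wz0[of k] by (intro mult_left_mono divide_left_mono) auto
      finally have "\<bar>?F (Suc n) k\<bar> \<le> ((6 * real n + 7) * (4 * real k + 1)) * ((real n + 1) / (real k + 1) * wz_term 0 k)"
        unfolding abs_mult by (intro mult_mono) (auto simp: algebra_simps)
      also have "\<dots> = (6 * real n + 7) * ((4 * real k + 1) * wz_term 0 k) * ((real n + 1) / (real k + 1))"
        by simp
      also have "\<dots> \<le> (6 * real n + 7) * B * ((real n + 1) / (real k + 1))"
        using B[of k] by (intro mult_right_mono mult_left_mono) auto
      finally show "norm (?F (Suc n) k) \<le> (6 * real n + 7) * B * ((real n + 1) / (real k + 1))" by simp
    qed
    show "(\<lambda>k. (6 * real n + 7) * B * ((real n + 1) / (real k + 1))) \<longlonglongrightarrow> 0" by real_asymp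
  qed
  have "(\<lambda>k. \<Sum>n. ?F n k) \<longlonglongrightarrow> (\<Sum>n. if n = 0 then 2 * sqrt 2 / pi else 0)"
  proof (rule tannerys_theorem[THEN conjunct2, THEN conjunct2])
    show "(\<lambda>k. ?F n k) \<longlonglongrightarrow> (if n = 0 then 2 * sqrt 2 / pi else 0)" for n
      using lim0 vanish[of "n - 1"] by (cases n) auto
    show "\<forall>\<^sub>F (n, k) in at_top \<times>\<^sub>F sequentially. norm (?F n k) \<le> (6 * real n + 1) * (B * (1/4) ^ n)"
      using bound by (intro always_eventually) auto
    have "summable (\<lambda>n. B * ((6 * real n + 1) * (1/4) ^ n))"
      by (intro summable_mult summable_linear_geometric) auto
    then show "summable (\<lambda>n. (6 * real n + 1) * (B * (1/4) ^ n))"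
      by (simp add: mult_ac)
  qed auto
  also have "(\<Sum>n. if n = 0 then 2 * sqrt 2 / pi else (0::real)) = 2 * sqrt 2 / pi"
    using suminf_finite[of "{0::nat}" "\<lambda>n. if n = 0 then 2 * sqrt 2 / pi else (0::real)"] by auto
  finally have "(\<Sum>n. (6 * real n + 1) * wz_term n 0) = 2 * sqrt 2 / pi"
    unfolding wz_sum_const by (simp add: LIMSEQ_const_iff)
  with wz_sum_summable[of 0] show ?thesis
    by (simp add: sums_iff wz_term_0_right)
qed

section \<open>A Pfaff--Saalschuetz summation\<close>

text \<open>
  Up to the sign \<open>(-1)\<^sup>n\<close>, the \<open>k\<close>-th term of the Legendre polynomial of degree \<open>2 n\<close> with \<open>t\<^sup>2\<^sup>k\<close>
  replaced by \<open>a\<^sub>k\<^sup>2\<close>, its mean under the law of a product of two independent arcsine variables. The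
  binomial coefficient in place of a quotient of factorials makes the terms with \<open>k > n\<close> vanish.
\<close>
definition legendre_mean_term :: "nat \<Rightarrow> nat \<Rightarrow> real" where
  "legendre_mean_term n k =
     (-1) ^ k * pochhammer (1/2) (n + k) * wallis_coeff k * real (n choose k) / (fact k * fact n)"

text \<open>
  Zeilberger's method: the combination of the terms for \<open>n + 1\<close> and \<open>n\<close> that encodes the recurrence of
  \<open>a\<^sub>n\<^sup>3\<close> is a difference \<open>G (k + 1) - G k\<close> for an explicit \<open>G\<close>, whose sum over all \<open>k\<close> is zero.
\<close>
lemma sum_legendre_mean_term: "(\<Sum>k\<le>n. legendre_mean_term n k) = wallis_coeff n ^ 3"
proof (induction n)
  case 0
  then show ?case by (simp add: legendre_mean_term_def)
next
  case (Suc n)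
  define x where "x = real n"
  define G where "G = (\<lambda>k. - (2 * x + 3/2) * real k ^ 3 * ((-1) ^ k * pochhammer (1/2) (n + k)
     * wallis_coeff k * real (Suc n choose k) / (fact k * fact (Suc n))))"
  \<comment> \<open>The range reaches \<open>k = n + 1\<close>, where the second term is zero but the first is not.\<close>
  have step: "(x + 1)^3 * legendre_mean_term (Suc n) k - (x + 1/2)^3 * legendre_mean_term n k = G (Suc k) - G k"
    if "k \<le> Suc n" for k
  proof -
    define y where "y = real k"
    define C where "C = (-1) ^ k * pochhammer (1/2) (n + k) * wallis_coeff k * real (Suc n choose k) / (fact k * fact (Suc n))"
    have x: "x + 1 > 0" and y: "y + 1 > 0" by (auto simp: x_def y_def)
    have "(Suc n - k) * (Suc n choose k) = Suc n * (n choose k)"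
      using binomial_absorb_comp[of "Suc n" k] by simp
    from arg_cong[OF this, of real]
    have b1: "real (n choose k) = (x + 1 - y) / (x + 1) * real (Suc n choose k)"
      using that x by (simp add: x_def y_def field_simps of_nat_diff)
    have "Suc k * (Suc n choose Suc k) = Suc n * (n choose k)"
      by (rule Suc_times_binomial)
    from arg_cong[OF this, of real]
    have b2: "real (Suc n choose Suc k) = (x + 1) / (y + 1) * real (n choose k)"
      using y by (simp only: x_def y_def of_nat_mult of_nat_Suc) (simp add: field_simps)
    \<comment> \<open>With the common factor \<open>C\<close> taken out, the step is a polynomial identity in \<open>x\<close> and \<open>y\<close>.\<close>
    have t1: "legendre_mean_term (Suc n) k = (x + y + 1/2) * C"
      by (simp add: legendre_mean_term_def C_def x_def y_def pochhammer_Suc)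
    have t2: "legendre_mean_term n k = (x + 1 - y) * C"
      unfolding legendre_mean_term_def b1 C_def using x by (simp add: x_def field_simps)
    have t3: "G (Suc k) = (2 * x + 3/2) * ((x + y + 1/2) * (y + 1/2) * (x + 1 - y)) * C"
    proof -
      have "G (Suc k) = - (2 * x + 3/2) * (y + 1) ^ 3 * ((-1) * (-1) ^ k * (pochhammer (1/2) (n + k) * (x + y + 1/2))
           * ((y + 1/2) / (y + 1) * wallis_coeff k) * ((x + 1) / (y + 1) * ((x + 1 - y) / (x + 1) * real (Suc n choose k)))
            / ((y + 1) * fact k * fact (Suc n)))"
        unfolding G_def b2 b1 by (simp add: x_def y_def pochhammer_Suc wallis_coeff_Suc add_ac)
      also have "\<dots> = (2 * x + 3/2) * ((x + y + 1/2) * (y + 1/2) * (x + 1 - y)) * C"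
        unfolding C_def using x y by (simp add: divide_simps power3_eq_cube)
      finally show ?thesis .
    qed
    have t4: "G k = - (2 * x + 3/2) * y ^ 3 * C"
      by (simp add: G_def C_def y_def)
    show ?thesis unfolding t1 t2 t3 t4 by (simp add: power3_eq_cube field_simps)
  qed
  have "(x + 1)^3 * (\<Sum>k\<le>Suc n. legendre_mean_term (Suc n) k) - (x + 1/2)^3 * (\<Sum>k\<le>Suc n. legendre_mean_term n k)
      = (\<Sum>k\<le>Suc n. G (Suc k) - G k)"
    unfolding sum_distrib_left sum_subtractf[symmetric] by (intro sum.cong refl step) auto
  also have "\<dots> = G (Suc (Suc n)) - G 0"
    unfolding lessThan_Suc_atMost[symmetric] by (rule sum_lessThan_telescope)
  also have "\<dots> = 0" by (simp add: G_def binomial_eq_0)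
  also have "(\<Sum>k\<le>Suc n. legendre_mean_term n k) = wallis_coeff n ^ 3"
    using Suc by (simp add: legendre_mean_term_def)
  finally have "(x + 1)^3 * (\<Sum>k\<le>Suc n. legendre_mean_term (Suc n) k) = ((x + 1/2) * wallis_coeff n) ^ 3"
    by (simp add: power_mult_distrib)
  moreover have "x + 1 > 0" by (simp add: x_def)
  ultimately have "(\<Sum>k\<le>Suc n. legendre_mean_term (Suc n) k) = ((x + 1/2) * wallis_coeff n) ^ 3 / (x + 1) ^ 3"
    by (simp add: field_simps)
  also have "\<dots> = wallis_coeff (Suc n) ^ 3"
    by (simp add: wallis_coeff_Suc x_def power_divide power_mult_distrib)
  finally show ?case .
qed

section \<open>Ramanujan's series with ratio \<open>32/81\<close> by rearrangement\<close>

text \<open>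
  The weight \<open>l\<close> is absorbed by \<open>l * (a gchoose l) = a * ((a - 1) gchoose (l - 1))\<close>, which leaves a
  binomial series with exponent \<open>a - 1\<close>.
\<close>
lemma gen_binomial_real_linear_weight:
  fixes z a c :: real
  assumes "\<bar>z\<bar> < 1"
  shows "(\<lambda>l. (c + real l) * (a gchoose l) * z ^ l) sums (c * (1 + z) powr a + a * z * (1 + z) powr (a - 1))"
proof -
  have "(\<lambda>l. a * z * (((a - 1) gchoose l) * z ^ l)) sums (a * z * (1 + z) powr (a - 1))"
    by (intro sums_mult gen_binomial_real assms)
  also have "(\<lambda>l. a * z * (((a - 1) gchoose l) * z ^ l)) = (\<lambda>l. real (Suc l) * (a gchoose Suc l) * z ^ Suc l)"
    unfolding gbinomial_absorption by (simp add: mult_ac)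
  finally have "(\<lambda>l. real l * (a gchoose l) * z ^ l) sums (a * z * (1 + z) powr (a - 1))"
    by (subst (asm) sums_Suc_iff) simp
  from sums_add[OF sums_mult[OF gen_binomial_real[OF assms], of c] this]
  show ?thesis by (simp add: algebra_simps)
qed

text \<open>
  With \<open>r\<^sup>2 = 1/8\<close>, the expansion of \<open>(1 + 2 r t + r\<^sup>2)\<close> to the power \<open>-1/2\<close> contains
  \<open>t\<^sup>2\<^sup>k r\<^sup>2\<^sup>(\<^sup>k\<^sup>+\<^sup>l\<^sup>)\<close> with the coefficient
  \<open>(-1)\<^sup>l (1/2)\<^sub>2\<^sub>k\<^sub>+\<^sub>l 4\<^sup>k / ((2 k)! l!)\<close>. Here \<open>t\<^sup>2\<^sup>k\<close> is replaced by \<open>a\<^sub>k\<^sup>2\<close>, and the linear factor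
  \<open>6 (k + l) + 1\<close> is the one of the series with ratio \<open>-1/8\<close>.
\<close>
definition double_term :: "nat \<times> nat \<Rightarrow> real" where
  "double_term = (\<lambda>(k, l). (6 * real (k + l) + 1) * ((-1) ^ l * pochhammer (1/2) (2 * k + l)
      / (fact (2 * k) * fact l)) * 4 ^ k * wallis_coeff k ^ 2 / 8 ^ (k + l))"

lemma double_term_row:
  "double_term (k, l) = 6 * wallis_coeff (2 * k) * wallis_coeff k ^ 2 * (1/2) ^ k
      * ((real k + 1/6 + real l) * ((-1/2 - 2 * real k) gchoose l) * (1/8) ^ l)"
proof -
  have "pochhammer (1/2 :: real) (2 * k + l) = pochhammer (1/2) (2 * k) * pochhammer (1/2 + 2 * real k) l"
    using pochhammer_product'[of "1/2 :: real" "2 * k" l] by (simp add: add.commute)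
  moreover have "(-1/2 - 2 * real k) gchoose l = (-1) ^ l * pochhammer (1/2 + 2 * real k) l / fact l"
    by (simp add: gbinomial_pochhammer add.commute)
  moreover have "(8 :: real) ^ k = 4 ^ k * 2 ^ k"
    by (simp flip: power_mult_distrib)
  ultimately show ?thesis
    by (simp add: double_term_def wallis_coeff_def power_add power_divide divide_simps)
qed

text \<open>
  The generalised binomial coefficients with negative upper index alternate in sign, so taking absolute
  values replaces \<open>1/8\<close> by \<open>-1/8\<close> in the binomial series of each row.
\<close>
lemma norm_double_term_row:
  "norm (double_term (k, l)) = 6 * wallis_coeff (2 * k) * wallis_coeff k ^ 2 * (1/2) ^ k
      * ((real k + 1/6 + real l) * ((-1/2 - 2 * real k) gchoose l) * (-1/8) ^ l)"
proof -
  have "\<bar>((-1/2 - 2 * real k) gchoose l)\<bar> = (-1) ^ l * ((-1/2 - 2 * real k) gchoose l)"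
    by (simp add: gbinomial_pochhammer abs_mult pochhammer_nonneg)
  moreover have "(-1/8 :: real) ^ l = (-1) ^ l * (1/8) ^ l"
    by (simp flip: power_mult_distrib)
  ultimately show ?thesis
    unfolding double_term_row real_norm_def abs_mult using wallis_coeff_pos
    by (simp add: abs_of_pos abs_mult)
qed

lemma powr_half_double:
  fixes c :: real
  assumes "c > 0"
  shows "c powr (-1/2 - 2 * real k) = c powr (-1/2) * (1 / c ^ 2) ^ k"
proof -
  have "c powr (-1/2 - 2 * real k) = c powr (-1/2) / c powr (real (2 * k))"
    by (simp flip: powr_diff)
  also have "c powr (real (2 * k)) = c ^ (2 * k)"
    using assms by (rule powr_realpow)
  finally show ?thesis by (simp add: power_mult power_divide)
qed

lemma double_term_row_sums:
  "(\<lambda>l. double_term (k, l)) sums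
     (4 * sqrt 2 / 9 * ((7 * real k + 1) * wallis_coeff (2 * k) * wallis_coeff k ^ 2 * (32/81) ^ k))"
proof -
  define a where "a = -1/2 - 2 * real k"
  have "(9/8 :: real) powr (-1/2) = 1 / sqrt (9/8)"
    by (simp add: powr_minus_divide powr_half_sqrt)
  also have "\<dots> = 2 * sqrt 2 / 3"
    using real_sqrt_mult[of 4 2] by (simp add: real_sqrt_divide divide_simps)
  finally have root: "(9/8 :: real) powr (-1/2) = 2 * sqrt 2 / 3" .
  have "(9/8 :: real) powr a = (9/8) powr (-1/2) * (1 / (9/8) ^ 2) ^ k"
    unfolding a_def by (rule powr_half_double) simp
  also have "1 / (9/8) ^ 2 = (64/81 :: real)"
    by (simp add: power_divide)
  finally have p: "(9/8 :: real) powr a = 2 * sqrt 2 / 3 * (64/81) ^ k"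
    unfolding root .
  have "(\<lambda>l. 6 * wallis_coeff (2 * k) * wallis_coeff k ^ 2 * (1/2) ^ k
      * ((real k + 1/6 + real l) * (a gchoose l) * (1/8) ^ l)) sums
     (6 * wallis_coeff (2 * k) * wallis_coeff k ^ 2 * (1/2) ^ k
      * ((real k + 1/6) * (1 + 1/8) powr a + a * (1/8) * (1 + 1/8) powr (a - 1)))"
    by (intro sums_mult gen_binomial_real_linear_weight) auto
  also have "(\<lambda>l. 6 * wallis_coeff (2 * k) * wallis_coeff k ^ 2 * (1/2) ^ k
      * ((real k + 1/6 + real l) * (a gchoose l) * (1/8) ^ l)) = (\<lambda>l. double_term (k, l))"
    unfolding double_term_row a_def by simp
  also have "(6 * wallis_coeff (2 * k) * wallis_coeff k ^ 2 * (1/2) ^ k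
      * ((real k + 1/6) * (1 + 1/8) powr a + a * (1/8) * (1 + 1/8) powr (a - 1)))
     = wallis_coeff (2 * k) * wallis_coeff k ^ 2 * (1/2) ^ k
      * (9/8) powr a * (6 * real k + 1 + 2/3 * a)"
    by (simp add: powr_diff field_simps)
  also have "\<dots> = wallis_coeff (2 * k) * wallis_coeff k ^ 2 * ((1/2) ^ k * (64/81) ^ k)
      * (2 * sqrt 2 / 3) * (6 * real k + 1 + 2/3 * a)"
    unfolding p by (simp add: mult_ac)
  also have "(1/2) ^ k * (64/81) ^ k = (32/81 :: real) ^ k"
    by (simp flip: power_mult_distrib)
  also have "6 * real k + 1 + 2/3 * a = 2/3 * (7 * real k + 1)"
    by (simp add: a_def field_simps)
  also have "wallis_coeff (2 * k) * wallis_coeff k ^ 2 * (32/81) ^ k * (2 * sqrt 2 / 3) * (2/3 * (7 * real k + 1))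
     = 4 * sqrt 2 / 9 * ((7 * real k + 1) * wallis_coeff (2 * k) * wallis_coeff k ^ 2 * (32/81) ^ k)"
    by simp
  finally show ?thesis .
qed

lemma norm_double_term_row_sums:
  "(\<lambda>l. norm (double_term (k, l))) sums
     ((8/7) powr (1/2) * wallis_coeff (2 * k) * wallis_coeff k ^ 2 * ((54/7 * real k + 10/7) * (32/49) ^ k))"
proof -
  define a where "a = -1/2 - 2 * real k"
  have "(7/8 :: real) powr (-1/2) = (8/7) powr (1/2)"
    using powr_minus[of "7/8::real" "1/2"] inverse_powr[of "7/8::real" "1/2"] by simp
  then have p: "(7/8 :: real) powr a = (8/7) powr (1/2) * (64/49) ^ k"
    unfolding a_def by (subst powr_half_double) (auto simp: power_divide)
  have "(\<lambda>l. 6 * wallis_coeff (2 * k) * wallis_coeff k ^ 2 * (1/2) ^ k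
      * ((real k + 1/6 + real l) * (a gchoose l) * (-1/8) ^ l)) sums
     (6 * wallis_coeff (2 * k) * wallis_coeff k ^ 2 * (1/2) ^ k
      * ((real k + 1/6) * (1 + (-1/8)) powr a + a * (-1/8) * (1 + (-1/8)) powr (a - 1)))"
    by (intro sums_mult gen_binomial_real_linear_weight) auto
  also have "(\<lambda>l. 6 * wallis_coeff (2 * k) * wallis_coeff k ^ 2 * (1/2) ^ k
      * ((real k + 1/6 + real l) * (a gchoose l) * (-1/8) ^ l)) = (\<lambda>l. norm (double_term (k, l)))"
    unfolding norm_double_term_row a_def by simp
  also have "(6 * wallis_coeff (2 * k) * wallis_coeff k ^ 2 * (1/2) ^ k
      * ((real k + 1/6) * (1 + (-1/8)) powr a + a * (-1/8) * (1 + (-1/8)) powr (a - 1)))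
     = wallis_coeff (2 * k) * wallis_coeff k ^ 2 * (1/2) ^ k
      * (7/8) powr a * (6 * real k + 1 - 6/7 * a)"
    by (simp add: powr_diff field_simps)
  also have "\<dots> = wallis_coeff (2 * k) * wallis_coeff k ^ 2 * ((1/2) ^ k * (64/49) ^ k)
      * (8/7) powr (1/2) * (6 * real k + 1 - 6/7 * a)"
    unfolding p by (simp add: mult_ac)
  also have "(1/2) ^ k * (64/49) ^ k = (32/49 :: real) ^ k"
    by (simp flip: power_mult_distrib)
  also have "6 * real k + 1 - 6/7 * a = 54/7 * real k + 10/7"
    by (simp add: a_def field_simps)
  finally show ?thesis by (simp add: mult_ac)
qed

text \<open>
  The absolute row sums are \<open>O(k (32/49)\<^sup>k)\<close>, where \<open>32/49 = 1/2 * (7/8)\<^sup>-\<^sup>2\<close>.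
\<close>
lemma double_term_abs_summable: "(\<lambda>p. norm (double_term p)) summable_on UNIV \<times> UNIV"
proof -
  let ?r = "\<lambda>k. (8/7) powr (1/2) * wallis_coeff (2 * k) * wallis_coeff k ^ 2 * ((54/7 * real k + 10/7) * (32/49) ^ k)"
  have row: "((\<lambda>l. norm (double_term (k, l))) has_sum ?r k) UNIV" for k
    by (intro sums_nonneg_imp_has_sum norm_double_term_row_sums) auto
  have r_nonneg: "?r k \<ge> 0" for k
    using wallis_coeff_pos[of k] wallis_coeff_pos[of "2*k"] by simp
  have "summable ?r"
  proof (rule summable_comparison_test')
    show "summable (\<lambda>k. (8/7) powr (1/2) * ((54/7 * real k + 10/7) * (32/49) ^ k))"
      by (intro summable_mult summable_linear_geometric) auto
    fix k :: nat
    have "wallis_coeff (2 * k) * wallis_coeff k ^ 2 \<le> 1 * 1 ^ 2"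
      using wallis_coeff_pos[of k] by (intro mult_mono power_mono wallis_coeff_le_1) auto
    from mult_right_mono[OF this, of "(8/7) powr (1/2) * ((54/7 * real k + 10/7) * (32/49) ^ k)"]
    have "?r k \<le> (8/7) powr (1/2) * ((54/7 * real k + 10/7) * (32/49) ^ k)"
      by (simp add: mult_ac)
    with r_nonneg[of k] show "norm (?r k) \<le> (8/7) powr (1/2) * ((54/7 * real k + 10/7) * (32/49) ^ k)"
      by simp
  qed
  then have "?r summable_on UNIV"
    by (subst summable_on_UNIV_nonneg_real_iff) (use r_nonneg in auto)
  moreover have "(\<lambda>k. norm (infsum (\<lambda>l. norm (double_term (k, l))) UNIV)) = ?r"
    unfolding infsumI[OF row] using r_nonneg by simp
  ultimately show ?thesis
    unfolding Infinite_Sum.abs_summable_on_Sigma_iff using has_sum_imp_summable[OF row] by simp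
qed

lemma double_term_diagonal:
  assumes "k \<le> n"
  shows "double_term (k, n - k) = (6 * real n + 1) * (-1) ^ n / 8 ^ n * legendre_mean_term n k"
proof -
  have w: "4 ^ k * wallis_coeff k / fact (2 * k) = 1 / fact k ^ 2"
    by (simp add: wallis_coeff_def pochhammer_half_double power2_eq_square)
  have c: "real (n choose k) / fact n = 1 / (fact k * fact (n - k))"
    using assms by (simp add: binomial_fact)
  have s: "(-1 :: real) ^ (n - k) = (-1) ^ n * (-1) ^ k"
    using assms by (metis minus_one_power_iff add_diff_inverse_nat even_add le_antisym mult_minus1 mult_minus1_right
        mult_1 mult_1_right not_less power_add minus_minus le_add_diff_inverse)
  have "2 * k + (n - k) = n + k" using assms by simp
  then have "double_term (k, n - k) = (6 * real n + 1) * (-1) ^ n / 8 ^ n * ((-1) ^ k * pochhammer (1/2) (n + k) * wallis_coeff k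
        * (4 ^ k * wallis_coeff k / fact (2 * k)) / fact (n - k))"
    using assms by (simp add: double_term_def s power2_eq_square add.commute mult_ac)
  also have "\<dots> = (6 * real n + 1) * (-1) ^ n / 8 ^ n * ((-1) ^ k * pochhammer (1/2) (n + k) * wallis_coeff k / fact k
        * (real (n choose k) / fact n))"
    unfolding w c by (simp add: power2_eq_square)
  finally show ?thesis by (simp add: legendre_mean_term_def)
qed

text \<open>
  The double series has the same sum along the rows, which carry the series claimed here, and along the
  diagonals \<open>k + l = n\<close>, which carry the series with ratio \<open>-1/8\<close>.
\<close>
lemma ramanujan_series_32_81:
  "(\<lambda>k. (7 * real k + 1) * wallis_coeff (2 * k) * wallis_coeff k ^ 2 * (32/81) ^ k) sums (9 / (2 * pi))"
proof -
  obtain S where S: "(double_term has_sum S) (UNIV \<times> UNIV)"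
    using Infinite_Sum.abs_summable_summable[OF double_term_abs_summable] by (auto simp: summable_on_def)
  let ?r = "\<lambda>k. (7 * real k + 1) * wallis_coeff (2 * k) * wallis_coeff k ^ 2 * (32/81) ^ k"
  have "((\<lambda>l. double_term (k, l)) has_sum (4 * sqrt 2 / 9 * ?r k)) UNIV" for k
    using norm_double_term_row_sums double_term_row_sums
    by (intro norm_summable_imp_has_sum) (auto simp: sums_iff)
  with S have "((\<lambda>k. 4 * sqrt 2 / 9 * ?r k) has_sum S) UNIV"
    by (intro has_sum_SigmaD[OF S]) auto
  then have rows: "(\<lambda>k. 4 * sqrt 2 / 9 * ?r k) sums S"
    by (rule has_sum_imp_sums)
  have "((\<lambda>(n, k). double_term (k, n - k)) has_sum S) (Sigma UNIV (\<lambda>n. {..n}))"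
    using S by (subst has_sum_reindex_bij_witness[where i = "\<lambda>(k, l). (k + l, k)" and j = "\<lambda>(n, k). (k, n - k)"
        and T = "UNIV \<times> UNIV" and h = double_term and s' = S]) auto
  then have "((\<lambda>n. \<Sum>k\<le>n. double_term (k, n - k)) has_sum S) UNIV"
    by (rule has_sum_SigmaD) (auto intro!: has_sum_finiteI)
  moreover have "(\<Sum>k\<le>n. double_term (k, n - k)) = (6 * real n + 1) * ((-1) ^ n * wallis_coeff n ^ 3 / 8 ^ n)" for n
  proof -
    have "(\<Sum>k\<le>n. double_term (k, n - k)) = (\<Sum>k\<le>n. (6 * real n + 1) * (-1) ^ n / 8 ^ n * legendre_mean_term n k)"
      by (intro sum.cong refl double_term_diagonal) auto
    then show ?thesis by (simp only: sum_distrib_left[symmetric] sum_legendre_mean_term) simp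
  qed
  ultimately have "(\<lambda>n. (6 * real n + 1) * ((-1) ^ n * wallis_coeff n ^ 3 / 8 ^ n)) sums S"
    using has_sum_imp_sums by simp
  with ramanujan_series_8 have "S = 2 * sqrt 2 / pi"
    by (rule sums_unique2[symmetric])
  with sums_mult[OF rows, of "9 / (4 * sqrt 2)"] show ?thesis
    by (simp add: mult_ac)
qed

section \<open>Even moments of the complementary elliptic integral\<close>

text \<open>
  Integrating the derivative of \<open>cos x * sin x ^ (2 k + 1)\<close> gives the recurrence
  \<open>(2 k + 2) W\<^sub>k\<^sub>+\<^sub>1 = (2 k + 1) W\<^sub>k\<close> for these integrals.
\<close>
lemma has_integral_sin_even_power:
  "((\<lambda>x. sin x ^ (2 * k)) has_integral (pi / 2 * wallis_coeff k)) {0..pi/2}"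
proof (induction k)
  case 0
  then show ?case using has_integral_const_real[of "1::real" 0 "pi/2"] by simp
next
  case (Suc k)
  have "((\<lambda>x. (2 * real k + 1) * sin x ^ (2 * k) - (2 * real k + 2) * sin x ^ (2 * Suc k)) has_integral
      (cos (pi/2) * sin (pi/2) ^ (2 * k + 1) - cos 0 * sin 0 ^ (2 * k + 1))) {0..pi/2}"
  proof (rule fundamental_theorem_of_calculus)
    fix x :: real assume "x \<in> {0..pi/2}"
    have "((\<lambda>x. sin x ^ (2 * k + 1)) has_real_derivative ((2 * real k + 1) * sin x ^ (2 * k) * cos x)) (at x within {0..pi/2})"
      by (rule DERIV_cong[OF DERIV_power[OF DERIV_subset[OF DERIV_sin]]]) auto
    from DERIV_mult[OF DERIV_subset[OF DERIV_cos] this]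
    have "((\<lambda>x. cos x * sin x ^ (2 * k + 1)) has_real_derivative
        (- sin x * sin x ^ (2 * k + 1) + (2 * real k + 1) * sin x ^ (2 * k) * cos x * cos x)) (at x within {0..pi/2})"
      by (simp add: algebra_simps)
    also have "(- sin x * sin x ^ (2 * k + 1) + (2 * real k + 1) * sin x ^ (2 * k) * cos x * cos x)
        = (2 * real k + 1) * sin x ^ (2 * k) * (cos x)\<^sup>2 - sin x ^ (2 * Suc k)"
      by (simp add: power2_eq_square)
    also have "\<dots> = (2 * real k + 1) * sin x ^ (2 * k) - (2 * real k + 2) * sin x ^ (2 * Suc k)"
      unfolding cos_squared_eq by (simp add: algebra_simps power2_eq_square)
    finally show "((\<lambda>x. cos x * sin x ^ (2 * k + 1)) has_vector_derivative
        ((2 * real k + 1) * sin x ^ (2 * k) - (2 * real k + 2) * sin x ^ (2 * Suc k))) (at x within {0..pi/2})"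
      by (simp add: has_real_derivative_iff_has_vector_derivative)
  qed simp
  from has_integral_diff[OF has_integral_mult_right[OF Suc, of "2 * real k + 1"] this]
  have "((\<lambda>x. (2 * real k + 2) * sin x ^ (2 * Suc k)) has_integral ((2 * real k + 1) * (pi / 2 * wallis_coeff k))) {0..pi/2}"
    by simp
  note scaled = has_integral_mult_right[OF this, of "1 / (2 * real k + 2)"]
  have cancel: "1 / (2 * real k + 2) * ((2 * real k + 2) * y) = y" for y :: real
    by simp
  have "((\<lambda>x. sin x ^ (2 * Suc k)) has_integral
      (1 / (2 * real k + 2) * ((2 * real k + 1) * (pi / 2 * wallis_coeff k)))) {0..pi/2}"
    using scaled unfolding cancel .
  also have "1 / (2 * real k + 2) * ((2 * real k + 1) * (pi / 2 * wallis_coeff k)) = pi / 2 * wallis_coeff (Suc k)"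
    by (simp add: wallis_coeff_Suc divide_simps)
  finally show ?case .
qed

definition arcsine_moment_kernel :: "nat \<Rightarrow> real \<Rightarrow> real" where
  "arcsine_moment_kernel k w = (if 0 < w \<and> w < 1 then w ^ (2 * k) / sqrt (1 - w\<^sup>2) else 0)"

lemma arcsine_moment_kernel_measurable [measurable]: "arcsine_moment_kernel k \<in> borel_measurable borel"
  unfolding arcsine_moment_kernel_def by measurable

lemma arcsine_moment_kernel_nonneg: "arcsine_moment_kernel k w \<ge> 0"
  by (auto simp: arcsine_moment_kernel_def abs_square_le_1)

lemma nn_integral_arcsine_moment_kernel:
  "(\<integral>\<^sup>+w. ennreal (arcsine_moment_kernel k w) \<partial>lborel) = ennreal (pi / 2 * wallis_coeff k)"
proof -
  have "(\<integral>\<^sup>+w. ennreal (arcsine_moment_kernel k w) \<partial>lborel)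
      = (\<integral>\<^sup>+w. ennreal (arcsine_moment_kernel k w * indicator {sin 0..sin (pi/2)} w) \<partial>lborel)"
    by (intro nn_integral_cong) (auto simp: arcsine_moment_kernel_def indicator_def)
  also have "\<dots> = (\<integral>\<^sup>+x. ennreal (arcsine_moment_kernel k (sin x) * cos x * indicator {0..pi/2} x) \<partial>lborel)"
  proof (rule nn_integral_substitution)
    show "set_borel_measurable borel {sin 0..sin (pi/2)} (arcsine_moment_kernel k)"
      unfolding set_borel_measurable_def by measurable
    show "0 \<le> cos x" if "x \<in> {0..pi/2}" for x
      using that by (auto intro: cos_ge_zero)
  qed (auto intro!: derivative_eq_intros continuous_intros)
  also have "\<dots> = (\<integral>\<^sup>+x. ennreal (sin x ^ (2 * k)) * indicator {0..pi/2} x \<partial>lborel)"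
  \<comment> \<open>At the end points the kernel has the value 0, but these form a null set.\<close>
  proof (rule nn_integral_cong_AE)
    have "AE x in lborel. x \<noteq> (0::real) \<and> x \<noteq> pi/2"
      using AE_lborel_singleton[of "0::real"] AE_lborel_singleton[of "pi/2"] by eventually_elim auto
    then show "AE x in lborel. ennreal (arcsine_moment_kernel k (sin x) * cos x * indicator {0..pi/2} x)
        = ennreal (sin x ^ (2 * k)) * indicator {0..pi/2} x"
    proof eventually_elim
      case (elim x)
      show ?case
      proof (cases "x \<in> {0..pi/2}")
        case True
        with elim have x: "0 < x" "x < pi/2" by auto
        then have "0 < sin x" "sin x < 1" "0 < cos x"
          using sin_gt_zero[of x] cos_gt_zero[of x] sin_monotone_2pi[of x "pi/2"] by auto
        moreover from this have "sqrt (1 - (sin x)\<^sup>2) = cos x"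
          by (simp flip: cos_squared_eq)
        ultimately show ?thesis using True by (simp add: arcsine_moment_kernel_def)
      qed auto
    qed
  qed
  also have "\<dots> = ennreal (pi / 2 * wallis_coeff k)"
    by (intro nn_integral_has_integral_lebesgue' has_integral_sin_even_power) auto
  finally show ?thesis .
qed

definition abel_kernel :: "real \<Rightarrow> real \<Rightarrow> real" where
  "abel_kernel t v = (if t < v \<and> v < 1 then 1 / (sqrt (1 - v\<^sup>2) * sqrt (v\<^sup>2 - t\<^sup>2)) else 0)"

lemma abel_kernel_measurable [measurable]:
  "case_prod abel_kernel \<in> borel_measurable (borel \<Otimes>\<^sub>M borel)"
  unfolding abel_kernel_def by measurable

text \<open>
  An extended nonnegative integral, so that measurability is immediate and Tonelli's theorem applies
  without integrability conditions.
\<close>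
definition complementary_K :: "real \<Rightarrow> ennreal" where
  "complementary_K t = (\<integral>\<^sup>+v. ennreal (abel_kernel t v) \<partial>lborel)"

lemma complementary_K_measurable [measurable]: "complementary_K \<in> borel_measurable borel"
  unfolding complementary_K_def by measurable

text \<open>
  The substitution \<open>v = g x = sqrt (1 - k\<^sup>2 sin\<^sup>2 x)\<close> satisfies \<open>1 - v\<^sup>2 = k\<^sup>2 sin\<^sup>2 x\<close> and
  \<open>v\<^sup>2 - t\<^sup>2 = k\<^sup>2 cos\<^sup>2 x\<close>, so all trigonometric factors cancel against the derivative and \<open>1 / g x\<close> remains.
  It is used on \<open>[-pi/2, 0]\<close>, where it increases; the integrand is even in \<open>x\<close>.
\<close>
lemma complementary_K_eq_ellipticK:
  assumes t: "0 < t" "t < 1" and k: "k\<^sup>2 = 1 - t\<^sup>2"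
  shows "complementary_K t = ennreal (ellipticK k)"
proof -
  define g where "g = (\<lambda>x. sqrt (1 - k\<^sup>2 * (sin x)\<^sup>2))"
  define g' where "g' = (\<lambda>x. - (k\<^sup>2 * sin x * cos x) / g x)"
  have t2: "t\<^sup>2 < 1" using t by (simp add: abs_square_less_1)
  have pos: "1 - k\<^sup>2 * (sin x)\<^sup>2 > 0" for x
  proof -
    have "k\<^sup>2 * (sin x)\<^sup>2 \<le> k\<^sup>2 * 1"
      using k t2 by (intro mult_left_mono) (auto simp: sin_squared_eq)
    also have "\<dots> < 1" using k t by simp
    finally show ?thesis by simp
  qed
  then have g_pos: "g x > 0" for x by (simp add: g_def)
  have g_end: "g (- (pi/2)) = t" "g 0 = 1"
    using t by (auto simp: g_def k)
  have deriv: "(g has_real_derivative g' x) (at x)" for x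
  proof -
    have "((\<lambda>x. 1 - k\<^sup>2 * (sin x)\<^sup>2) has_real_derivative (- (2 * k\<^sup>2 * sin x * cos x))) (at x)"
      by (auto intro!: derivative_eq_intros)
    from DERIV_chain2[OF DERIV_real_sqrt[OF pos] this]
    have "(g has_real_derivative (inverse (sqrt (1 - k\<^sup>2 * (sin x)\<^sup>2)) / 2 * (- (2 * k\<^sup>2 * sin x * cos x)))) (at x)"
      unfolding g_def .
    moreover have "inverse y / 2 * (- (2 * k\<^sup>2 * sin x * cos x)) = - (k\<^sup>2 * sin x * cos x) / y" for y :: real
      by (cases "y = 0") (simp_all add: field_simps)
    ultimately show ?thesis unfolding g'_def g_def by metis
  qed
  have cont: "continuous_on A g" for A
    using DERIV_isCont[OF deriv] by (intro continuous_at_imp_continuous_on) auto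
  have "complementary_K t = (\<integral>\<^sup>+v. ennreal (abel_kernel t v * indicator {g (- (pi/2))..g 0} v) \<partial>lborel)"
    unfolding complementary_K_def g_end
    by (intro nn_integral_cong) (auto simp: abel_kernel_def indicator_def)
  also have "\<dots> = (\<integral>\<^sup>+x. ennreal (abel_kernel t (g x) * g' x * indicator {- (pi/2)..0} x) \<partial>lborel)"
  proof (rule nn_integral_substitution)
    show "set_borel_measurable borel {g (- (pi/2))..g 0} (abel_kernel t)"
      unfolding set_borel_measurable_def by measurable
    show "0 \<le> g' x" if "x \<in> {- (pi/2)..0}" for x
    proof -
      have "cos x \<ge> 0" "sin (- x) \<ge> 0"
        using that by (auto intro!: cos_ge_zero simp del: sin_minus intro: sin_ge_zero)
      moreover have "g' x = k\<^sup>2 * sin (- x) * cos x / g x" by (simp add: g'_def)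
      ultimately show ?thesis using g_pos[of x]
        by (simp only:) (intro divide_nonneg_pos mult_nonneg_nonneg zero_le_power2)
    qed
    show "continuous_on {- (pi/2)..0} g'"
      unfolding g'_def using g_pos by (intro continuous_intros cont) (auto simp: less_imp_neq[symmetric])
  qed (auto simp: deriv)
  also have "\<dots> = (\<integral>\<^sup>+x. ennreal (1 / g x) * indicator {- (pi/2)..0} x \<partial>lborel)"
  proof (rule nn_integral_cong_AE)
    have "AE x in lborel. x \<noteq> (0::real) \<and> x \<noteq> - (pi/2)"
      using AE_lborel_singleton[of "0::real"] AE_lborel_singleton[of "- (pi/2)"] by eventually_elim auto
    then show "AE x in lborel. ennreal (abel_kernel t (g x) * g' x * indicator {- (pi/2)..0} x)
        = ennreal (1 / g x) * indicator {- (pi/2)..0} x"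
    proof eventually_elim
      case (elim x)
      show ?case
      proof (cases "x \<in> {- (pi/2)..0}")
        case True
        with elim have x: "0 < -x" "-x < pi/2" by auto
        define c s where "c = cos x" and "s = - sin x"
        have c: "c > 0" and s: "s > 0"
          using sin_gt_zero[of "-x"] cos_gt_zero[of "-x"] x by (auto simp: c_def s_def)
        have cs: "c\<^sup>2 + s\<^sup>2 = 1" by (simp add: c_def s_def)
        define q where "q = sqrt (1 - t\<^sup>2)"
        have q: "q > 0" "q\<^sup>2 = k\<^sup>2" using t2 k by (auto simp: q_def)
        have gx: "(g x)\<^sup>2 = 1 - k\<^sup>2 * s\<^sup>2"
          using pos[of x] by (simp add: g_def s_def)
        have 1: "1 - (g x)\<^sup>2 = (q * s)\<^sup>2" by (simp add: gx power_mult_distrib q)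
        have "(g x)\<^sup>2 - t\<^sup>2 = k\<^sup>2 * (1 - s\<^sup>2)" using k gx by (simp add: algebra_simps)
        then have 2: "(g x)\<^sup>2 - t\<^sup>2 = (q * c)\<^sup>2"
          using cs by (simp add: power_mult_distrib q)
        have "0 < (q * s)\<^sup>2" "0 < (q * c)\<^sup>2"
          using q(1) s c by simp_all
        with 1 2 have "(g x)\<^sup>2 < 1\<^sup>2" "t\<^sup>2 < (g x)\<^sup>2"
          unfolding one_power2 by linarith+
        then have 3: "g x < 1" and 4: "t < g x"
          using power2_less_imp_less[of "g x" 1] power2_less_imp_less[of t "g x"] g_pos[of x] by simp_all
        have "abel_kernel t (g x) = 1 / ((q * s) * (q * c))"
          using q s c by (simp only: abel_kernel_def 1 2) (simp add: 3 4)
        moreover have "g' x = q\<^sup>2 * s * c / g x"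
          by (simp add: g'_def q s_def c_def)
        ultimately have "abel_kernel t (g x) * g' x = 1 / ((q * s) * (q * c)) * (q\<^sup>2 * s * c / g x)"
          by (simp only:)
        also have "\<dots> = 1 / g x"
          using q(1) s c by (simp add: power2_eq_square)
        finally have "abel_kernel t (g x) * g' x = 1 / g x" .
        then show ?thesis using True by simp
      qed auto
    qed
  qed
  also have "\<dots> = ennreal (ellipticK k)"
  proof (rule nn_integral_has_integral_lebesgue')
    show "0 \<le> 1 / g x" for x using g_pos[of x] by simp
    have "continuous_on {0..pi/2} (\<lambda>x. 1 / g x)"
      using g_pos by (intro continuous_intros cont) (auto simp: less_imp_neq[symmetric])
    then have "((\<lambda>x. 1 / g x) has_integral ellipticK k) {0..pi/2}"
      unfolding ellipticK_def g_def by (intro integrable_integral integrable_continuous_real)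
    from has_integral_reflect_lemma_real[OF this]
    show "((\<lambda>x. 1 / g x) has_integral ellipticK k) {- (pi/2)..0}"
      by (simp add: g_def)
  qed
  finally show ?thesis .
qed

text \<open>
  Tonelli's theorem and the scaling \<open>t = v w\<close> in the inner integral separate the variables: the double
  integral becomes the product of the same Wallis integral in \<open>v\<close> and in \<open>w\<close>.
\<close>
lemma complementary_K_moment:
  "(\<integral>\<^sup>+t. ennreal (if 0 < t \<and> t < 1 then t ^ (2 * k) else 0) * complementary_K t \<partial>lborel)
     = ennreal ((pi / 2 * wallis_coeff k)\<^sup>2)"
proof -
  let ?p = "\<lambda>t::real. if 0 < t \<and> t < 1 then t ^ (2 * k) else 0"
  let ?W = "pi / 2 * wallis_coeff k"
  have "(\<integral>\<^sup>+t. ennreal (?p t) * complementary_K t \<partial>lborel)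
      = (\<integral>\<^sup>+t. \<integral>\<^sup>+v. ennreal (?p t * abel_kernel t v) \<partial>lborel \<partial>lborel)"
    unfolding complementary_K_def
    by (intro nn_integral_cong, subst nn_integral_cmult[symmetric])
       (auto simp: ennreal_mult' zero_le_power intro!: nn_integral_cong)
  also have "\<dots> = (\<integral>\<^sup>+v. \<integral>\<^sup>+t. ennreal (?p t * abel_kernel t v) \<partial>lborel \<partial>lborel)"
    by (rule lborel_pair.Fubini') measurable
  also have "\<dots> = (\<integral>\<^sup>+v. ennreal (arcsine_moment_kernel k v) * ennreal ?W \<partial>lborel)"
  proof (rule nn_integral_cong)
    fix v :: real
    show "(\<integral>\<^sup>+t. ennreal (?p t * abel_kernel t v) \<partial>lborel) = ennreal (arcsine_moment_kernel k v) * ennreal ?W"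
    proof (cases "0 < v \<and> v < 1")
      case True
      have scale: "?p (0 + v * w) * abel_kernel (0 + v * w) v = 1 / v * arcsine_moment_kernel k v * arcsine_moment_kernel k w" for w
      proof (cases "0 < w \<and> w < 1")
        case w: True
        have "v * w < v" "v * w > 0"
          using True w mult_strict_left_mono[of w 1 v] by auto
        moreover from this have "v * w < 1" using True by linarith
        moreover have "sqrt (v\<^sup>2 - (v * w)\<^sup>2) = v * sqrt (1 - w\<^sup>2)"
        proof -
          have "v\<^sup>2 - (v * w)\<^sup>2 = v\<^sup>2 * (1 - w\<^sup>2)" by (simp add: power_mult_distrib algebra_simps)
          then show ?thesis using True by (simp add: real_sqrt_mult)
        qed
        ultimately show ?thesis
          using True w by (simp add: arcsine_moment_kernel_def abel_kernel_def power_mult_distrib)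
      next
        case w: False
        then have "\<not> (0 < v * w \<and> v * w < v)" using True by (auto simp: zero_less_mult_iff)
        with w show ?thesis by (auto simp: arcsine_moment_kernel_def abel_kernel_def)
      qed
      have "(\<integral>\<^sup>+t. ennreal (?p t * abel_kernel t v) \<partial>lborel)
          = ennreal \<bar>v\<bar> * (\<integral>\<^sup>+w. ennreal (?p (0 + v * w) * abel_kernel (0 + v * w) v) \<partial>lborel)"
        using True by (intro nn_integral_real_affine) auto
      also have "\<dots> = ennreal v * (\<integral>\<^sup>+w. ennreal (1 / v * arcsine_moment_kernel k v) * ennreal (arcsine_moment_kernel k w) \<partial>lborel)"
      proof -
        have "0 \<le> 1 / v * arcsine_moment_kernel k v"
          using True by (intro mult_nonneg_nonneg arcsine_moment_kernel_nonneg) auto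
        moreover have "\<bar>v\<bar> = v" using True by simp
        ultimately show ?thesis unfolding scale by (simp only: ennreal_mult')
      qed
      also have "\<dots> = ennreal v * ennreal (1 / v * arcsine_moment_kernel k v) * ennreal ?W"
        by (simp add: nn_integral_cmult nn_integral_arcsine_moment_kernel mult.assoc)
      also have "ennreal v * ennreal (1 / v * arcsine_moment_kernel k v) = ennreal (arcsine_moment_kernel k v)"
        using True by (subst ennreal_mult'[symmetric]) auto
      finally show ?thesis .
    next
      case False
      then have 0: "?p t * abel_kernel t v = 0" for t
        by (auto simp: abel_kernel_def)
      have "arcsine_moment_kernel k v = 0"
        using False by (auto simp: arcsine_moment_kernel_def)
      then show ?thesis unfolding 0 by simp
    qed
  qed
  also have "\<dots> = ennreal ?W * ennreal ?W"
    by (simp add: nn_integral_multc nn_integral_arcsine_moment_kernel)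
  also have "\<dots> = ennreal (?W\<^sup>2)"
    unfolding power2_eq_square using wallis_coeff_pos[of k] by (intro ennreal_mult'[symmetric]) auto
  finally show ?thesis .
qed

section \<open>Evaluation of the integral\<close>

lemma ellipticK_nonneg:
  assumes "k\<^sup>2 \<le> 1"
  shows "ellipticK k \<ge> 0"
proof -
  have "k\<^sup>2 * (sin x)\<^sup>2 \<le> 1 * 1" for x
    using assms by (intro mult_mono) (auto simp: abs_square_le_1)
  then have "0 \<le> 1 / sqrt (1 - k\<^sup>2 * (sin x)\<^sup>2)" for x by simp
  then show ?thesis
    unfolding ellipticK_def
    by (cases "(\<lambda>x. 1 / sqrt (1 - k\<^sup>2 * (sin x)\<^sup>2)) integrable_on {0..pi/2}")
       (auto intro: integral_nonneg simp: not_integrable_integral)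
qed

definition weight :: "real \<Rightarrow> real" where
  "weight t = (3 * sqrt 2 - 2 * t) / (9 + 4 * sqrt 2 * t) powr (3/2)"

lemma weight_measurable [measurable]: "weight \<in> borel_measurable borel"
  unfolding weight_def by measurable

text \<open>
  With \<open>u = 4 sqrt 2 t / 9\<close>, the weight is the combination
  \<open>sqrt 2 / 36 * (7 (1 + u) powr (-3/2) - 3 (1 + u) powr (-1/2))\<close>, and \<open>(1 + u) powr (-3/2)\<close> has the
  coefficients \<open>(2 j + 1) (-1/2 gchoose j)\<close>. This is the origin of the linear factor \<open>2/7 + j\<close>, which
  for \<open>j = 2 k\<close> is proportional to \<open>7 k + 1\<close>. The series converges for \<open>\<bar>t\<bar> \<le> 1\<close> since \<open>4 sqrt 2 < 9\<close>.
\<close>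
lemma weight_sums:
  assumes "\<bar>t\<bar> \<le> 1"
  shows "(\<lambda>j. 7/18 * sqrt 2 * ((2/7 + real j) * (-1/2 gchoose j) * (4 * sqrt 2 * t / 9) ^ j)) sums weight t"
    and "weight t \<ge> 0"
proof -
  define u where "u = 4 * sqrt 2 * t / 9"
  have s: "sqrt 2 < 3/2" by (rule real_less_lsqrt) (auto simp: power2_eq_square)
  have s1: "1 \<le> sqrt 2" by simp
  have "\<bar>u\<bar> = 4 * sqrt 2 * \<bar>t\<bar> / 9" by (simp add: u_def abs_mult)
  also have "\<dots> \<le> 4 * sqrt 2 * 1 / 9"
    using assms by (intro divide_right_mono mult_left_mono) auto
  also have "\<dots> < 1" using s by simp
  finally have u: "\<bar>u\<bar> < 1" .
  then have D: "1 + u > 0" by linarith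
  have den: "9 + 4 * sqrt 2 * t = 9 * (1 + u)" by (simp add: u_def)
  show "weight t \<ge> 0"
    unfolding weight_def by (intro divide_nonneg_nonneg) (use assms s1 in linarith, simp)
  have "(9::real) powr (3/2) = 9 powr (1 + 1/2)" by simp
  also have "\<dots> = 27" by (subst powr_add) (simp add: powr_half_sqrt)
  finally have nine: "(9::real) powr (3/2) = 27" .
  have "(\<lambda>j. 7/18 * sqrt 2 * ((2/7 + real j) * (-1/2 gchoose j) * u ^ j)) sums
     (7/18 * sqrt 2 * (2/7 * (1 + u) powr (-1/2) + (-1/2) * u * (1 + u) powr (-1/2 - 1)))"
    by (intro sums_mult gen_binomial_real_linear_weight u)
  also have "(1 + u) powr (-1/2) = (1 + u) powr (1 + (-3/2))" by simp
  also have "\<dots> = (1 + u) * (1 + u) powr (-3/2)" using D by (subst powr_add) simp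
  also have "-1/2 - 1 = (-3/2 :: real)" by simp
  also have "(1 + u) powr (-3/2) = 1 / (1 + u) powr (3/2)"
    using powr_minus_divide[of "1 + u" "3/2"] by simp
  also have "7/18 * sqrt 2 * (2/7 * ((1 + u) * (1 / (1 + u) powr (3/2))) + (-1/2) * u * (1 / (1 + u) powr (3/2)))
      = (sqrt 2 / 9 - sqrt 2 * u / 12) / (1 + u) powr (3/2)"
    using D by (simp add: field_simps)
  also have "sqrt 2 * u = 8 * t / 9" by (simp add: u_def)
  also have "(sqrt 2 / 9 - 8 * t / 9 / 12) / (1 + u) powr (3/2) = weight t"
    unfolding weight_def den using D by (simp add: powr_mult nine del: distrib_left_numeral) (simp add: field_simps)
  finally show "(\<lambda>j. 7/18 * sqrt 2 * ((2/7 + real j) * (-1/2 gchoose j) * (4 * sqrt 2 * t / 9) ^ j)) sums weight t"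
    unfolding u_def .
qed

lemma weight_even_part_sums:
  assumes "\<bar>t\<bar> \<le> 1"
  shows "(\<lambda>k. 2 * sqrt 2 / 9 * ((7 * real k + 1) * wallis_coeff (2 * k) * (32/81) ^ k) * t ^ (2 * k))
           sums (weight t + weight (- t))"
proof -
  define c where "c = (\<lambda>j. 7/18 * sqrt 2 * ((2/7 + real j) * (-1/2 gchoose j)))"
  define u where "u = 4 * sqrt 2 * t / 9"
  have "(\<lambda>j. c j * u ^ j + c j * (- u) ^ j) sums (weight t + weight (- t))"
  proof (rule sums_add)
    show "(\<lambda>j. c j * u ^ j) sums weight t"
      using weight_sums(1)[of t] assms by (simp only: c_def u_def mult.assoc)
    have "4 * sqrt 2 * (- t) / 9 = - u" by (simp add: u_def)
    with weight_sums(1)[of "- t"] assms show "(\<lambda>j. c j * (- u) ^ j) sums weight (- t)"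
      by (simp only: c_def mult.assoc abs_minus_cancel)
  qed
  moreover have "c n * u ^ n + c n * (- u) ^ n = 0" if "n \<notin> range (\<lambda>k. 2 * k)" for n
  proof -
    have "odd n" using that by (auto elim: evenE)
    then show ?thesis by simp
  qed
  ultimately have "(\<lambda>k. c (2 * k) * u ^ (2 * k) + c (2 * k) * (- u) ^ (2 * k)) sums (weight t + weight (- t))"
    by (subst sums_mono_reindex[where g = "\<lambda>k. 2 * k"]) (auto simp: strict_mono_def)
  moreover have "c (2 * k) * u ^ (2 * k) + c (2 * k) * (- u) ^ (2 * k)
     = 2 * sqrt 2 / 9 * ((7 * real k + 1) * wallis_coeff (2 * k) * (32/81) ^ k) * t ^ (2 * k)" for k
  proof -
    have "(-1/2 :: real) gchoose (2 * k) = wallis_coeff (2 * k)"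
      by (simp add: gbinomial_pochhammer wallis_coeff_def)
    moreover have "u ^ (2 * k) = (32/81) ^ k * t ^ (2 * k)"
      by (simp add: u_def power_mult power_mult_distrib power_divide)
    ultimately show ?thesis by (simp add: c_def field_simps)
  qed
  ultimately show ?thesis by (simp only:)
qed

text \<open>
  All coefficients of the even part are nonnegative, so monotone convergence justifies the interchange of
  sum and integral; the moments then turn the power series into Ramanujan's series.
\<close>
lemma nn_integral_even_part:
  "(\<integral>\<^sup>+t. ennreal (if 0 < t \<and> t < 1 then weight t + weight (- t) else 0) * complementary_K t \<partial>lborel)
     = ennreal (pi * sqrt 2 / 4)"
proof -
  let ?p = "\<lambda>k t. if 0 < t \<and> t < 1 then t ^ (2 * k) else (0::real)"
  define c where "c = (\<lambda>k. 2 * sqrt 2 / 9 * ((7 * real k + 1) * wallis_coeff (2 * k) * (32/81) ^ k))"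
  have c_nonneg: "c k \<ge> 0" for k
    using wallis_coeff_pos[of "2 * k"] by (simp add: c_def)
  have p_nonneg: "?p k t \<ge> 0" for k t by simp
  have expand: "ennreal (if 0 < t \<and> t < 1 then weight t + weight (- t) else 0) = (\<Sum>k. ennreal (c k) * ennreal (?p k t))" for t
  proof -
    have "(\<lambda>k. c k * ?p k t) sums (if 0 < t \<and> t < 1 then weight t + weight (- t) else 0)"
      using weight_even_part_sums[of t] by (auto simp: c_def)
    from suminf_ennreal_eq[OF _ this] c_nonneg p_nonneg show ?thesis
      by (simp add: ennreal_mult' del: mult_zero_right)
  qed
  have "(\<integral>\<^sup>+t. ennreal (if 0 < t \<and> t < 1 then weight t + weight (- t) else 0) * complementary_K t \<partial>lborel)
      = (\<integral>\<^sup>+t. (\<Sum>k. ennreal (c k) * (ennreal (?p k t) * complementary_K t)) \<partial>lborel)"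
    unfolding expand by (simp add: mult.assoc flip: ennreal_suminf_multc)
  also have "\<dots> = (\<Sum>k. \<integral>\<^sup>+t. ennreal (c k) * (ennreal (?p k t) * complementary_K t) \<partial>lborel)"
    by (rule nn_integral_suminf) measurable
  also have "\<dots> = (\<Sum>k. ennreal (c k * (pi / 2 * wallis_coeff k)\<^sup>2))"
    using c_nonneg by (simp add: nn_integral_cmult complementary_K_moment ennreal_mult')
  also have "\<dots> = ennreal (pi\<^sup>2 * sqrt 2 / 18 * (9 / (2 * pi)))"
  proof (rule suminf_ennreal_eq)
    show "0 \<le> c k * (pi / 2 * wallis_coeff k)\<^sup>2" for k using c_nonneg[of k] by simp
    show "(\<lambda>k. c k * (pi / 2 * wallis_coeff k)\<^sup>2) sums (pi\<^sup>2 * sqrt 2 / 18 * (9 / (2 * pi)))"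
      using sums_mult[OF ramanujan_series_32_81, of "pi\<^sup>2 * sqrt 2 / 18"]
      by (simp add: c_def power2_eq_square mult_ac)
  qed
  also have "pi\<^sup>2 * sqrt 2 / 18 * (9 / (2 * pi)) = pi * sqrt 2 / 4"
    by (simp add: power2_eq_square)
  finally show ?thesis .
qed

text \<open>
  The centre \<open>y = 0\<close>, at which \<open>K'\<close> has its logarithmic singularity, and the end points \<open>\<bar>y\<bar> = 1\<close> are left
  out, since \<open>complementary_K_eq_ellipticK\<close> covers only \<open>0 < \<bar>y\<bar> < 1\<close>.
\<close>
lemma nn_integral_weight:
  defines "E \<equiv> (\<lambda>y. if y \<noteq> 0 \<and> \<bar>y\<bar> < 1 then ennreal (weight y) * complementary_K \<bar>y\<bar> else 0)"
  shows "(\<integral>\<^sup>+x. E (1 - 2 * x) \<partial>lborel) = ennreal (pi / (4 * sqrt 2))"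
proof -
  have [measurable]: "E \<in> borel_measurable borel" unfolding E_def by measurable
  have "ennreal 2 * (\<integral>\<^sup>+x. E (1 - 2 * x) \<partial>lborel) = (\<integral>\<^sup>+y. E y \<partial>lborel)"
    using nn_integral_real_affine[of E "-2" 1] by simp
  \<comment> \<open>Folding the negative half-line onto the positive one leaves twice the even part of the weight.\<close>
  also have "\<dots> = (\<integral>\<^sup>+y. E y * indicator {0<..} y + E y * indicator {..<0} y \<partial>lborel)"
    by (intro nn_integral_cong) (auto simp: E_def indicator_def)
  also have "\<dots> = (\<integral>\<^sup>+y. E y * indicator {0<..} y \<partial>lborel) + (\<integral>\<^sup>+y. E y * indicator {..<0} y \<partial>lborel)"
    by (rule nn_integral_add) auto
  also have "(\<integral>\<^sup>+y. E y * indicator {..<0} y \<partial>lborel) = (\<integral>\<^sup>+y. E (- y) * indicator {..<0} (- y) \<partial>lborel)"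
    using nn_integral_real_affine[of "\<lambda>y. E y * indicator {..<0} y" "-1" 0] by simp
  also have "(\<integral>\<^sup>+y. E y * indicator {0<..} y \<partial>lborel) + (\<integral>\<^sup>+y. E (- y) * indicator {..<0} (- y) \<partial>lborel)
      = (\<integral>\<^sup>+y. E y * indicator {0<..} y + E (- y) * indicator {..<0} (- y) \<partial>lborel)"
    by (rule nn_integral_add[symmetric]) auto
  also have "\<dots> = (\<integral>\<^sup>+t. ennreal (if 0 < t \<and> t < 1 then weight t + weight (- t) else 0) * complementary_K t \<partial>lborel)"
    by (intro nn_integral_cong) (auto simp: E_def indicator_def distrib_right weight_sums(2) ennreal_plus)
  also have "\<dots> = ennreal 2 * ennreal (pi / (4 * sqrt 2))"
    unfolding nn_integral_even_part
    by (subst ennreal_mult'[symmetric]) (auto simp: real_div_sqrt field_simps)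
  finally show ?thesis
    by (simp add: ennreal_mult_cancel_left)
qed

theorem mainTheorem2:
  shows "((\<lambda>x::real. ellipticK (2 * sqrt (x * (1 - x))) * (4 * x + 3 * sqrt 2 - 2)
            / (4 * sqrt 2 + 9 - 8 * sqrt 2 * x) powr (3 / 2))
          has_integral (pi / (4 * sqrt 2))) {0..1}"
proof -
  define F where "F = (\<lambda>x::real. ellipticK (2 * sqrt (x * (1 - x))) * (4 * x + 3 * sqrt 2 - 2)
            / (4 * sqrt 2 + 9 - 8 * sqrt 2 * x) powr (3 / 2))"
  define E where "E = (\<lambda>y. if y \<noteq> 0 \<and> \<bar>y\<bar> < 1 then ennreal (weight y) * complementary_K \<bar>y\<bar> else 0)"
  have [measurable]: "E \<in> borel_measurable borel" unfolding E_def by measurable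
  have zero: "E (1 - 2 * x) = 0" if "\<not> (0 < x \<and> x < 1 \<and> x \<noteq> 1/2)" for x
    using that by (auto simp: E_def)
  have F: "E (1 - 2 * x) = ennreal (F x)" "F x \<ge> 0" if x: "0 < x" "x < 1" "x \<noteq> 1/2" for x
  proof -
    let ?k = "2 * sqrt (x * (1 - x))"
    have "?k\<^sup>2 = 4 * (x * (1 - x))" using x by (simp add: power_mult_distrib)
    then have k: "?k\<^sup>2 = 1 - \<bar>1 - 2 * x\<bar>\<^sup>2" by (simp add: power2_eq_square algebra_simps)
    have w: "weight (1 - 2 * x) \<ge> 0" using x by (intro weight_sums) auto
    have K: "ellipticK ?k \<ge> 0" by (rule ellipticK_nonneg) (simp only: k, simp)
    have eq: "F x = weight (1 - 2 * x) * ellipticK ?k"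
      by (simp add: F_def weight_def algebra_simps)
    show "F x \<ge> 0" using w K by (simp add: eq)
    have "complementary_K \<bar>1 - 2 * x\<bar> = ennreal (ellipticK ?k)"
      using x k by (intro complementary_K_eq_ellipticK) auto
    then show "E (1 - 2 * x) = ennreal (F x)"
      using x w by (simp add: E_def eq ennreal_mult')
  qed
  have fin: "ennreal (enn2real (E (1 - 2 * x))) = E (1 - 2 * x)" for x
    using F[of x] zero[of x] by (cases "0 < x \<and> x < 1 \<and> x \<noteq> 1/2") auto
  have "(\<integral>\<^sup>+x. E (1 - 2 * x) \<partial>lborel) = ennreal (pi / (4 * sqrt 2))"
    using nn_integral_weight by (simp only: E_def)
  then have "((\<lambda>x. enn2real (E (1 - 2 * x))) has_integral (pi / (4 * sqrt 2))) UNIV"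
    by (intro nn_integral_has_integral) (auto simp: fin)
  also have "(\<lambda>x. enn2real (E (1 - 2 * x))) = (\<lambda>x. if x \<in> {0..1} then enn2real (E (1 - 2 * x)) else 0)"
    using zero by (intro ext) auto
  finally have "((\<lambda>x. enn2real (E (1 - 2 * x))) has_integral (pi / (4 * sqrt 2))) {0..1}"
    by (simp only: has_integral_restrict_UNIV)
  then have "(F has_integral (pi / (4 * sqrt 2))) {0..1}"
    by (rule has_integral_spike_finite[rotated 2, where S = "{0, 1/2, 1}"]) (auto simp: F)
  then show ?thesis unfolding F_def .
qed

end
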